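(* Let $w\in S_n$, $\boldsymbol\alpha:[n]\to\{1,-1\}$ and define $\boldsymbol\epsilon(w,\boldsymbol\alpha):[n]\times[n]\to\{1,-1\}$ by $$\boldsymbol\epsilon(w,\boldsymbol\alpha)(i,j)=\delta_{i,j}\boldsymbol\alpha(i)+\operatorname{sign}(w(j)-w(i)),\qquad i,j\in[n].$$ Then $\boldsymbol\epsilon(w,\boldsymbol\alpha)$ is transitive. Moreover, all transitive maps $\mathbf c:[n]\times[n]\to\{1,-1\}$ satisfying $\mathbf c(j,i)=-\mathbf c(i,j)$ for all $1\le i<j\le n$ are obtained this way. In particular, there are $n!\,2^n$ such maps.
   Context: $[n]=\{1,\dots,n\}$, $\delta_{i,j}$ is the Kronecker delta and $\operatorname{sign}(0)=0$. A map $\mathbf c:[n]\times[n]\to C$ is transitive if $\mathbf c(i,k)\in\{\mathbf c(i,j),\mathbf c(j,k)\}$ for all $i,j,k\in[n]$ (not necessarily distinct). *)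

theory Defs
  imports Main "HOL-Library.FuncSet" "HOL-Combinatorics.Permutations"
begin

text \<open>
  Maps with domain \<open>[n]\<close> or \<open>[n] \<times> [n]\<close> are elements of the extensional function space
  \<open>\<rightarrow>\<^sub>E\<close> (value \<open>undefined\<close> off the domain), so that equality and cardinality of sets of
  such maps have their usual meaning.
\<close>

definition transitive_map :: "nat \<Rightarrow> (nat \<times> nat \<Rightarrow> 'c) \<Rightarrow> bool" where
  "transitive_map n c \<longleftrightarrow>
     (\<forall>i\<in>{1..n}. \<forall>j\<in>{1..n}. \<forall>k\<in>{1..n}. c (i, k) \<in> {c (i, j), c (j, k)})"

definition sign_maps :: "nat \<Rightarrow> (nat \<times> nat \<Rightarrow> int) set" where
  "sign_maps n = {1..n} \<times> {1..n} \<rightarrow>\<^sub>E {1, -1}"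

definition epsilon_map :: "nat \<Rightarrow> (nat \<Rightarrow> nat) \<Rightarrow> (nat \<Rightarrow> int) \<Rightarrow> nat \<times> nat \<Rightarrow> int" where
  "epsilon_map n w \<alpha> =
     restrict (\<lambda>(i, j). of_bool (i = j) * \<alpha> i + sgn (int (w j) - int (w i)))
       ({1..n} \<times> {1..n})"

definition skew_off_diagonal :: "nat \<Rightarrow> (nat \<times> nat \<Rightarrow> int) \<Rightarrow> bool" where
  "skew_off_diagonal n c \<longleftrightarrow> (\<forall>i j. 1 \<le> i \<and> i < j \<and> j \<le> n \<longrightarrow> c (j, i) = - c (i, j))"

end

theory Submission
  imports Defs
begin

text \<open>
  Off the diagonal, a transitive skew map with values \<open>1\<close> and \<open>-1\<close> is a strict linear order
  on \<open>[n]\<close>, read as \<open>i < j\<close> iff \<open>c (i, j) = 1\<close>, while the diagonal values are unconstrained.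
  The permutation \<open>w\<close> sends each element to its rank in that order.
\<close>

text \<open>Since \<open>w\<close> is injective with image \<open>{1..n}\<close> and
  \<open>w i \<le> n\<close>, it carries the set on the right bijectively onto
  \<open>{1..w i}\<close>. This recovers the value \<open>w i\<close> from comparisons between
  values alone.\<close>

lemma permutes_eq_card_le:
  assumes "w permutes {1..n::nat}" "i \<in> {1..n}"
  shows "w i = card {k \<in> {1..n}. w k \<le> w i}"
proof -
  have wi: "w i \<in> {1..n}" using assms by (simp only: permutes_in_image)
  have "w ` {k \<in> {1..n}. w k \<le> w i} = {l \<in> w ` {1..n}. l \<le> w i}" by blast
  also have "\<dots> = {1..w i}"
    using wi unfolding permutes_image[OF assms(1)] by auto
  finally have "card (w ` {k \<in> {1..n}. w k \<le> w i}) = w i" by simp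
  then show ?thesis
    using card_image[OF permutes_inj_on[OF assms(1), of "{k \<in> {1..n}. w k \<le> w i}"]] by simp
qed

lemma permutes_eqI_less_iff:
  assumes w: "w permutes {1..n::nat}" and w': "w' permutes {1..n}"
    and iff: "\<And>i j. i \<in> {1..n} \<Longrightarrow> j \<in> {1..n} \<Longrightarrow> w i < w j \<longleftrightarrow> w' i < w' j"
  shows "w = w'"
proof
  fix i
  show "w i = w' i"
  proof (cases "i \<in> {1..n}")
    case True
    \<comment> \<open>\<open>w k \<le> w i\<close> is the negation of \<open>w i < w k\<close>, so
      agreement on strict comparisons is enough.\<close>
    have "{k \<in> {1..n}. w k \<le> w i} = {k \<in> {1..n}. w' k \<le> w' i}"
      using iff[OF True] by (metis (no_types, lifting) linorder_not_less)
    then show ?thesis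
      using permutes_eq_card_le[OF w True] permutes_eq_card_le[OF w' True] by simp
  next
    case False
    then show ?thesis using w w' by (simp add: permutes_not_in)
  qed
qed

lemma epsilon_map_apply:
  assumes "i \<in> {1..n}" "j \<in> {1..n}"
  shows "epsilon_map n w \<alpha> (i, j) = of_bool (i = j) * \<alpha> i + sgn (int (w j) - int (w i))"
  using assms by (simp add: epsilon_map_def)

lemma epsilon_map_diag:
  "i \<in> {1..n} \<Longrightarrow> epsilon_map n w \<alpha> (i, i) = \<alpha> i"
  by (simp add: epsilon_map_apply)

lemma epsilon_map_off_diag:
  assumes "w permutes {1..n}" "i \<in> {1..n}" "j \<in> {1..n}" "i \<noteq> j"
  shows "epsilon_map n w \<alpha> (i, j) = (if w i < w j then 1 else -1)"
proof -
  have "w i \<noteq> w j" using assms permutes_inj[OF assms(1)] by (auto dest: injD)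
  then show ?thesis using assms by (simp add: epsilon_map_apply sgn_if)
qed

lemma epsilon_map_in_sign_maps:
  assumes "w permutes {1..n}" "\<alpha> \<in> {1..n} \<rightarrow>\<^sub>E {1, -1}"
  shows "epsilon_map n w \<alpha> \<in> sign_maps n"
  unfolding sign_maps_def
proof (rule PiE_I)
  fix p assume "p \<in> {1..n} \<times> {1..n}"
  then obtain i j where p: "p = (i, j)" and ij: "i \<in> {1..n}" "j \<in> {1..n}" by blast
  show "epsilon_map n w \<alpha> p \<in> {1, -1}"
  proof (cases "i = j")
    case True
    then show ?thesis using p ij PiE_mem[OF assms(2) ij(1)] by (simp add: epsilon_map_diag)
  next
    case False
    then show ?thesis using p epsilon_map_off_diag[OF assms(1) ij] by simp
  qed
next
  fix p assume "p \<notin> {1..n} \<times> {1..n}"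
  then show "epsilon_map n w \<alpha> p = undefined" by (simp add: epsilon_map_def)
qed

lemma skew_epsilon_map: "skew_off_diagonal n (epsilon_map n w \<alpha>)"
  unfolding skew_off_diagonal_def by (auto simp: epsilon_map_apply sgn_if)

lemma skew_off_diagonalD:
  assumes "skew_off_diagonal n c" "i \<in> {1..n}" "j \<in> {1..n}" "i \<noteq> j"
  shows "c (j, i) = - c (i, j)"
proof (cases "i < j")
  case True
  then show ?thesis using assms unfolding skew_off_diagonal_def by simp
next
  case False
  then have "c (i, j) = - c (j, i)" using assms unfolding skew_off_diagonal_def by simp
  then show ?thesis by simp
qed

lemma transitive_epsilon_map:
  assumes w: "w permutes {1..n}" and \<alpha>: "\<alpha> \<in> {1..n} \<rightarrow>\<^sub>E {1, -1}"
  shows "transitive_map n (epsilon_map n w \<alpha>)"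
  unfolding transitive_map_def
proof (intro ballI)
  fix i j k assume ijk: "i \<in> {1..n}" "j \<in> {1..n}" "k \<in> {1..n}"
  let ?e = "epsilon_map n w \<alpha>"
  show "?e (i, k) \<in> {?e (i, j), ?e (j, k)}"
  proof (cases "i = j \<or> j = k")
    case False
    show ?thesis
    proof (cases "i = k")
      case True
      \<comment> \<open>For \<open>i = k\<close> the two candidates are opposite signs and exhaust
        \<open>{1, -1}\<close>, so any diagonal value \<alpha> is admissible.\<close>
      have "?e (j, i) = - ?e (i, j)"
        using skew_off_diagonalD[OF skew_epsilon_map ijk(1,2)] False by blast
      moreover have "?e (i, j) \<in> {1, -1}"
        using epsilon_map_off_diag[OF w ijk(1,2)] False by simp
      ultimately show ?thesis
        using True epsilon_map_diag[OF ijk(1), of w \<alpha>] PiE_mem[OF \<alpha> ijk(1)] by auto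
    next
      case ik: False
      \<comment> \<open>For distinct indices only equal candidates constrain the value; then
        \<open>w j\<close> lies strictly between \<open>w i\<close> and \<open>w k\<close>, which
        forces the same sign.\<close>
      then show ?thesis using False ijk by (auto simp: epsilon_map_off_diag[OF w])
    qed
  \<comment> \<open>If \<open>i = j\<close> or \<open>j = k\<close>, then \<open>(i, k)\<close> is
    itself one of the two pairs on the right.\<close>
  qed auto
qed

text \<open>If \<open>c (i, j) = 1\<close>, transitivity makes the down-set of \<open>i\<close> a
  proper subset of that of \<open>j\<close>. Hence the sizes of down-sets are ordered as
  \<open>c\<close> prescribes, and \<alpha> is the diagonal of \<open>c\<close>.\<close>

lemma epsilon_map_surj:
  assumes c: "c \<in> sign_maps n" and tr: "transitive_map n c" and sk: "skew_off_diagonal n c"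
  obtains w \<alpha> where "w permutes {1..n}" "\<alpha> \<in> {1..n} \<rightarrow>\<^sub>E {1, -1}" "c = epsilon_map n w \<alpha>"
proof -
  \<comment> \<open>The down-set of \<open>j\<close>. As \<open>c (j, j)\<close> may be either sign,
    \<open>j\<close> is inserted by hand, so that ranks start at 1 rather than 0.\<close>
  define L where "L j = insert j {i \<in> {1..n}. i \<noteq> j \<and> c (i, j) = 1}" for j
  \<comment> \<open>The rank, extended by the identity because \<open>permutes\<close> demands fixed
    points outside \<open>{1..n}\<close>.\<close>
  define w where "w j = (if j \<in> {1..n} then card (L j) else j)" for j
  define \<alpha> where "\<alpha> = restrict (\<lambda>i. c (i, i)) {1..n}"
  have val: "c (i, j) \<in> {1, -1}" if "i \<in> {1..n}" "j \<in> {1..n}" for i j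
    using PiE_mem[OF c[unfolded sign_maps_def], of "(i, j)"] that by simp
  have skew: "c (j, i) = - c (i, j)" if "i \<in> {1..n}" "j \<in> {1..n}" "i \<noteq> j" for i j
    using skew_off_diagonalD[OF sk that] .
  have L_sub: "L j \<subseteq> {1..n}" if "j \<in> {1..n}" for j
    using that by (auto simp: L_def)
  have less: "w i < w j" if ij: "i \<in> {1..n}" "j \<in> {1..n}" "i \<noteq> j" "c (i, j) = 1" for i j
  proof -
    have "j \<notin> L i" using ij skew[OF ij(1-3)] by (simp add: L_def)
    moreover have "L i \<subseteq> L j"
    proof
      fix h assume h: "h \<in> L i"
      then have hn: "h \<in> {1..n}" and hj: "h \<noteq> j" using L_sub[OF ij(1)] \<open>j \<notin> L i\<close> by blast+
      have "c (h, j) = 1"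
      proof (cases "h = i")
        case False
        then have "c (h, i) = 1" using h by (simp add: L_def)
        \<comment> \<open>Transitivity through \<open>i\<close>: both \<open>c (h, i)\<close> and
          \<open>c (i, j)\<close> equal 1.\<close>
        then show ?thesis using tr hn ij unfolding transitive_map_def by (metis insert_iff singletonD)
      qed (simp add: ij)
      then show "h \<in> L j" using hn hj by (simp add: L_def)
    qed
    moreover have "j \<in> L j" by (simp add: L_def)
    ultimately have "L i \<subset> L j" by blast
    moreover have "finite (L j)" using L_sub[OF ij(2)] finite_subset by blast
    ultimately show ?thesis using ij by (simp add: w_def psubset_card_mono)
  qed
  have greater: "w j < w i" if ij: "i \<in> {1..n}" "j \<in> {1..n}" "i \<noteq> j" "c (i, j) = -1" for i j
    using less[of j i] ij skew[OF ij(1-3)] by simp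
  \<comment> \<open>Any two distinct elements are comparable under \<open>c\<close>, so
    \<open>less\<close> or \<open>greater\<close> separates their ranks.\<close>
  have inj: "inj_on w {1..n}"
    by (rule inj_onI) (metis less greater val insert_iff singletonD less_irrefl)
  have w_in: "w j \<in> {1..n}" if j: "j \<in> {1..n}" for j
  proof -
    have "finite (L j)" using L_sub[OF j] finite_subset by blast
    then have "card (L j) \<noteq> 0" by (auto simp: L_def)
    moreover have "card (L j) \<le> n" using card_mono[OF _ L_sub[OF j]] by simp
    ultimately show ?thesis using j by (simp add: w_def)
  qed
  have "w ` {1..n} = {1..n}"
    by (rule endo_inj_surj[OF _ _ inj]) (use w_in in auto)
  with inj have "bij_betw w {1..n} {1..n}" by (simp add: bij_betw_def)
  then have perm: "w permutes {1..n}"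
    by (rule bij_imp_permutes) (auto simp: w_def)
  have \<alpha>: "\<alpha> \<in> {1..n} \<rightarrow>\<^sub>E {1, -1}"
    unfolding \<alpha>_def using val by (intro restrict_PiE_iff[THEN iffD2]) blast
  have "c = epsilon_map n w \<alpha>"
  proof (rule PiE_ext)
    show "c \<in> {1..n} \<times> {1..n} \<rightarrow>\<^sub>E {1, -1}"
      "epsilon_map n w \<alpha> \<in> {1..n} \<times> {1..n} \<rightarrow>\<^sub>E {1, -1}"
      using c epsilon_map_in_sign_maps[OF perm \<alpha>] by (simp_all only: sign_maps_def)
    fix p assume "p \<in> {1..n} \<times> {1..n}"
    then obtain i j where p: "p = (i, j)" and ij: "i \<in> {1..n}" "j \<in> {1..n}" by blast
    show "c p = epsilon_map n w \<alpha> p"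
    proof (cases "i = j")
      case True
      then show ?thesis unfolding p using epsilon_map_diag ij by (simp add: \<alpha>_def)
    next
      case False
      then show ?thesis
        unfolding p epsilon_map_off_diag[OF perm ij False]
        using val[OF ij] less[OF ij False] greater[OF ij False] by auto
    qed
  qed
  then show thesis using that perm \<alpha> by blast
qed

text \<open>The diagonal returns \<alpha>, and the off-diagonal signs return every comparison
  \<open>w i < w j\<close>, which determines \<open>w\<close>.\<close>

lemma epsilon_map_inject:
  assumes w: "w permutes {1..n}" "w' permutes {1..n}"
    and \<alpha>: "\<alpha> \<in> {1..n} \<rightarrow>\<^sub>E {1, -1}" "\<alpha>' \<in> {1..n} \<rightarrow>\<^sub>E {1, -1}"
    and eq: "epsilon_map n w \<alpha> = epsilon_map n w' \<alpha>'"
  shows "w = w' \<and> \<alpha> = \<alpha>'"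
proof
  show "\<alpha> = \<alpha>'"
    using \<alpha> by (rule PiE_ext) (metis eq epsilon_map_diag)
  show "w = w'"
  proof (rule permutes_eqI_less_iff[OF w])
    fix i j assume ij: "i \<in> {1..n}" "j \<in> {1..n}"
    show "w i < w j \<longleftrightarrow> w' i < w' j"
    proof (cases "i = j")
      case False
      have "(if w i < w j then 1 else - 1 :: int) = (if w' i < w' j then 1 else - 1)"
        using eq epsilon_map_off_diag[OF w(1) ij False] epsilon_map_off_diag[OF w(2) ij False]
        by metis
      then show ?thesis by (simp split: if_splits)
    qed simp
  qed
qed

theorem lemma3p2:
  fixes n :: nat
  shows "(\<forall>w \<alpha>. w permutes {1..n} \<and> \<alpha> \<in> {1..n} \<rightarrow>\<^sub>E {1, -1} \<longrightarrow>
             epsilon_map n w \<alpha> \<in> sign_maps n \<and> transitive_map n (epsilon_map n w \<alpha>)) \<and>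
         (\<forall>c \<in> sign_maps n. transitive_map n c \<and> skew_off_diagonal n c \<longrightarrow>
             (\<exists>w \<alpha>. w permutes {1..n} \<and> \<alpha> \<in> {1..n} \<rightarrow>\<^sub>E {1, -1} \<and> c = epsilon_map n w \<alpha>)) \<and>
         card {c \<in> sign_maps n. transitive_map n c \<and> skew_off_diagonal n c} = fact n * 2 ^ n"
proof (intro conjI)
  show "\<forall>w \<alpha>. w permutes {1..n} \<and> \<alpha> \<in> {1..n} \<rightarrow>\<^sub>E {1, -1} \<longrightarrow>
      epsilon_map n w \<alpha> \<in> sign_maps n \<and> transitive_map n (epsilon_map n w \<alpha>)"
    using epsilon_map_in_sign_maps transitive_epsilon_map by blast
  show "\<forall>c \<in> sign_maps n. transitive_map n c \<and> skew_off_diagonal n c \<longrightarrow>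
      (\<exists>w \<alpha>. w permutes {1..n} \<and> \<alpha> \<in> {1..n} \<rightarrow>\<^sub>E {1, -1} \<and> c = epsilon_map n w \<alpha>)"
    using epsilon_map_surj by metis
  \<comment> \<open>The count transfers along the bijection from pairs of a permutation and a sign
    vector.\<close>
  let ?D = "{w. w permutes {1..n}} \<times> ({1..n} \<rightarrow>\<^sub>E {1, -1 :: int})"
  let ?e = "\<lambda>(w, \<alpha>). epsilon_map n w \<alpha>"
  have "{c \<in> sign_maps n. transitive_map n c \<and> skew_off_diagonal n c} = ?e ` ?D"
  proof (intro equalityI subsetI)
    fix c assume "c \<in> {c \<in> sign_maps n. transitive_map n c \<and> skew_off_diagonal n c}"
    then obtain w \<alpha> where "w permutes {1..n}" "\<alpha> \<in> {1..n} \<rightarrow>\<^sub>E {1, -1}" "c = epsilon_map n w \<alpha>"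
      using epsilon_map_surj by blast
    then show "c \<in> ?e ` ?D" by (intro image_eqI[of _ _ "(w, \<alpha>)"]) auto
  next
    fix c assume "c \<in> ?e ` ?D"
    then show "c \<in> {c \<in> sign_maps n. transitive_map n c \<and> skew_off_diagonal n c}"
      using epsilon_map_in_sign_maps transitive_epsilon_map skew_epsilon_map by auto
  qed
  moreover have "inj_on ?e ?D"
    by (rule inj_onI) (use epsilon_map_inject in fastforce)
  moreover have "card ?D = fact n * 2 ^ n"
    \<comment> \<open>\<open>numeral_2_eq_2\<close> puts 2 into the successor form in which the size
      of \<open>{1, -1}\<close> is computed.\<close>
    by (simp add: card_cartesian_product card_permutations[of _ n] card_PiE numeral_2_eq_2)
  ultimately show "card {c \<in> sign_maps n. transitive_map n c \<and> skew_off_diagonal n c} = fact n * 2 ^ n"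
    by (simp only: card_image)
qed

end
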